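(* For every positive integer $m$, $$0=\tfrac12 h^{c(m+3,m+2)}_{1,1},\qquad \eta_{1/4}(m+1)=\tfrac12 h^{c(m+3,m+2)}_{3,1},$$ $$1-\eta_{1/4}(m)=\tfrac12 h^{c(m+3,m+2)}_{1,3},\qquad \eta_{1/4}(m+1)-\eta_{1/4}(m)=\tfrac12 h^{c(m+3,m+2)}_{3,3}.$$
   Context: For $\alpha$ a scalar, $\eta_\alpha(m)=\dfrac{\alpha m}{2+2\alpha(m-2)}$, so $\eta_{1/4}(m)=\dfrac{m}{2(m+2)}$. For coprime integers $p,q\ge 2$, $c(p,q)=1-\frac{6(p-q)^2}{pq}$, and $$h^{c(p,q)}_{r,s}=\frac{(sp-rq)^2-(p-q)^2}{4pq},$$ which for $1\le r<p$, $1\le s<q$ are the possible highest weights of irreducible modules of the Virasoro algebra of central charge $c(p,q)$. Here $h^{c(p,q)}_{r,s}$ denotes the value of this formula (with $p=m+3$, $q=m+2$ in this order) for the given indices $r,s$. *)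

theory Defs
  imports Complex_Main
begin

definition eta :: "real \<Rightarrow> nat \<Rightarrow> real" where
  "eta \<alpha> m = \<alpha> * real m / (2 + 2 * \<alpha> * (real m - 2))"

definition central_charge :: "nat \<Rightarrow> nat \<Rightarrow> real" where
  "central_charge p q = 1 - 6 * (real p - real q)\<^sup>2 / (real p * real q)"

(* The highest weight at central charge "central_charge p q".  It depends on the ordered
   pair (p, q): exchanging p and q fixes the central charge but exchanges r and s.
   No range restriction on r, s is imposed. *)
definition highest_weight :: "nat \<Rightarrow> nat \<Rightarrow> nat \<Rightarrow> nat \<Rightarrow> real" where
  "highest_weight p q r s =
     ((real s * real p - real r * real q)\<^sup>2 - (real p - real q)\<^sup>2) / (4 * real p * real q)"

end

theory Submission imports Defs begin

text \<open>With \<open>p = m + 3\<close> and \<open>q = m + 2\<close>, \<open>p - q = 1\<close>, so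
  each numerator is N^2 - 1 = (N - 1)(N + 1). For (3,1) a factor cancels \<open>q\<close>, for (1,3)
  it cancels \<open>p\<close>; for (3,3) the numerator is 8. All four claims become rational
  identities in \<open>m\<close>.\<close>

lemma eta_quarter: "eta (1/4) m = real m / (2 * (real m + 2))"
  by (simp add: eta_def field_simps)

theorem mainTheorem2:
  fixes m :: nat
  assumes "m \<ge> 1"
  shows "0 = 1/2 * highest_weight (m + 3) (m + 2) 1 1
       \<and> eta (1/4) (m + 1) = 1/2 * highest_weight (m + 3) (m + 2) 3 1
       \<and> 1 - eta (1/4) m = 1/2 * highest_weight (m + 3) (m + 2) 1 3
       \<and> eta (1/4) (m + 1) - eta (1/4) m = 1/2 * highest_weight (m + 3) (m + 2) 3 3"
proof -
  define x where "x = real m"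
  have nz: "x + 2 \<noteq> 0" "x + 3 \<noteq> 0"
    unfolding x_def by linarith+
  have cast: "real (m + 1) = x + 1" "real (m + 2) = x + 2" "real (m + 3) = x + 3" "real m = x"
    by (simp_all add: x_def)
  \<comment> \<open>\<open>eta_quarter\<close> at \<open>m + 1\<close> has denominator
    \<open>2 * (x + 1 + 2)\<close>; this form lets \<open>nz\<close> clear it.\<close>
  have shift: "x + 1 + 2 = x + 3"
    by simp
  show ?thesis
    unfolding eta_quarter highest_weight_def cast shift
    using nz by (simp add: divide_simps) (simp add: algebra_simps power2_eq_square)
qed

end
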